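(* Let $G$ be a simple graph of order $n\geq 6$ that contains neither $\theta(1,2,2)$ nor $F_{5}$ as a subgraph. Then $q(G)\leq q(S_{n,1}^{+})$, with equality if and only if $G\cong S_{n,1}^{+}$.
   Context: All graphs are finite and simple. For a graph $G$, $Q(G)=D(G)+A(G)$ is its signless Laplacian matrix, where $D(G)$ is the diagonal matrix of vertex degrees and $A(G)$ the adjacency matrix; $q(G)$ denotes the largest eigenvalue of $Q(G)$. The theta graph $\theta(l_{1},l_{2},l_{3})$ consists of two vertices joined by three internally vertex-disjoint paths of lengths $l_{1},l_{2},l_{3}$; thus $\theta(1,2,2)$ is $K_4$ minus an edge. $F_5$ is the graph consisting of two triangles sharing exactly one vertex. $S_{n,k}$ denotes the graph on $n$ vertices obtained by joining every vertex of $K_{k}$ to each of $n-k$ further mutually nonadjacent vertices, and $S_{n,k}^{+}$ is obtained from $S_{n,k}$ by adding one edge between two of these $n-k$ vertices. In particular $S_{n,1}^{+}$ is the star $K_{1,n-1}$ with one extra edge joining two leaves. *)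

theory Defs
  imports "Graph_Theory.Graph_Theory" "Jordan_Normal_Form.Spectral_Radius"
begin

text \<open>
  A finite simple graph is a \<^const>\<open>pair_graph\<close>: a finite vertex set with a symmetric, irreflexive
  set of arcs, in which the edge \<open>{u,v}\<close> is the pair of arcs \<open>(u,v)\<close>, \<open>(v,u)\<close>.
\<close>

section \<open>The signless Laplacian\<close>

text \<open>
  Matrices are indexed by numbers, so the vertices are listed in some order; a different
  order conjugates all the matrices below by the same permutation matrix
  (see \<open>eigenvalue_signless_laplacian_iff\<close>).
\<close>

definition vertex_list :: "'a pair_pre_digraph \<Rightarrow> 'a list" where
  "vertex_list G = (SOME vs. distinct vs \<and> set vs = pverts G)"

definition adjacency_matrix :: "'a pair_pre_digraph \<Rightarrow> real mat" where
  "adjacency_matrix G = (let n = card (pverts G); vs = vertex_list G in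
     mat n n (\<lambda>(i, j). if (vs ! i, vs ! j) \<in> parcs G then 1 else 0))"

text \<open>In a symmetric digraph the out-degree of a vertex is the degree in the undirected graph.\<close>

definition degree_matrix :: "'a pair_pre_digraph \<Rightarrow> real mat" where
  "degree_matrix G = (let n = card (pverts G); vs = vertex_list G in
     mat n n (\<lambda>(i, j). if i = j then real (out_degree G (vs ! i)) else 0))"

definition signless_laplacian :: "'a pair_pre_digraph \<Rightarrow> real mat" where
  "signless_laplacian G = degree_matrix G + adjacency_matrix G"

definition q_index :: "'a pair_pre_digraph \<Rightarrow> real" where
  "q_index G = Max (spectrum (signless_laplacian G))"

section \<open>Graphs\<close>

text \<open>\<open>H\<close> is contained in \<open>G\<close> as a (not necessarily induced) subgraph, up to isomorphism.\<close>

definition contains_subgraph :: "'a pair_pre_digraph \<Rightarrow> 'b pair_pre_digraph \<Rightarrow> bool" where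
  "contains_subgraph G H \<longleftrightarrow>
     (\<exists>H' :: 'a pair_pre_digraph. subgraph H' G \<and> digraph_iso H H')"

text \<open>
  The \<open>j\<close>-th vertex (\<open>0 \<le> j \<le> l\<close>) of the \<open>i\<close>-th path, of length \<open>l\<close>, of a theta graph. The common
  ends are \<open>(0,0)\<close> and \<open>(0,1)\<close>; the internal vertices have positive first component.
\<close>

definition theta_vertex :: "nat \<Rightarrow> nat \<Rightarrow> nat \<Rightarrow> nat \<times> nat" where
  "theta_vertex i l j = (if j = 0 then (0, 0) else if j = l then (0, 1) else (i, j))"

text \<open>The result is a theta graph if all lengths are positive and at most one of them is 1.\<close>

definition theta :: "nat \<Rightarrow> nat \<Rightarrow> nat \<Rightarrow> (nat \<times> nat) pair_pre_digraph" where
  "theta l1 l2 l3 = mk_symmetric (with_proj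
     \<lparr> pverts = (\<Union>(i, l) \<in> {(1, l1), (2, l2), (3, l3)}. theta_vertex i l ` {0..l}),
       parcs = (\<Union>(i, l) \<in> {(1, l1), (2, l2), (3, l3)}.
         (\<lambda>j. (theta_vertex i l j, theta_vertex i l (Suc j))) ` {0..<l}) \<rparr>)"

definition F5 :: "nat pair_pre_digraph" where
  "F5 = mk_symmetric (with_proj
     \<lparr> pverts = {0, 1, 2, 3, 4}, parcs = {(0, 1), (1, 2), (0, 2), (0, 3), (3, 4), (0, 4)} \<rparr>)"

text \<open>\<open>S_graph n k\<close> requires \<open>k \<le> n\<close>, and \<open>S_plus_graph n k\<close> requires \<open>k + 2 \<le> n\<close>;
  the clique is \<open>{0..<k}\<close>.\<close>

definition S_graph :: "nat \<Rightarrow> nat \<Rightarrow> nat pair_pre_digraph" where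
  "S_graph n k = \<lparr> pverts = {0..<n},
     parcs = {(i, j). i < n \<and> j < n \<and> i \<noteq> j \<and> (i < k \<or> j < k)} \<rparr>"

definition S_plus_graph :: "nat \<Rightarrow> nat \<Rightarrow> nat pair_pre_digraph" where
  "S_plus_graph n k = (S_graph n k)
     \<lparr> parcs := parcs (S_graph n k) \<union> {(k, Suc k), (Suc k, k)} \<rparr>"

section \<open>Basic facts\<close>

lemma theta_1_2_2:
  "pverts (theta 1 2 2) = {(0,0), (0,1), (2,1), (3,1)}"
  "parcs (theta 1 2 2) =
     {(u, v). u \<in> pverts (theta 1 2 2) \<and> v \<in> pverts (theta 1 2 2) \<and> u \<noteq> v}
       - {((2,1), (3,1)), ((3,1), (2,1))}"
proof -
  have ivl: "{0..1::nat} = {0, 1}" "{0..2::nat} = {0, 1, 2}" "{0..<1::nat} = {0}" "{0..<2::nat} = {0, 1}"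
    by auto
  show V: "pverts (theta 1 2 2) = {(0,0), (0,1), (2,1), (3,1)}"
    unfolding theta_def mk_symmetric_def
    by (simp add: ivl theta_vertex_def del: One_nat_def) auto
  have P: "parcs (theta 1 2 2) = {((0,0), (0,1)), ((0,1), (0,0)),
      ((0,0), (2,1)), ((2,1), (0,0)), ((2,1), (0,1)), ((0,1), (2,1)),
      ((0,0), (3,1)), ((3,1), (0,0)), ((3,1), (0,1)), ((0,1), (3,1))}"
    unfolding theta_def mk_symmetric_def
    by (simp add: ivl theta_vertex_def del: One_nat_def) auto
  show "parcs (theta 1 2 2) =
     {(u, v). u \<in> pverts (theta 1 2 2) \<and> v \<in> pverts (theta 1 2 2) \<and> u \<noteq> v}
       - {((2,1), (3,1)), ((3,1), (2,1))}"
    unfolding V P by auto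
qed

lemma pair_graph_theta_1_2_2: "pair_graph (theta 1 2 2)"
proof
  show "symmetric (theta 1 2 2)"
    unfolding symmetric_def with_proj_simps theta_1_2_2 by (auto intro!: symI)
  show "finite (parcs (theta 1 2 2))"
    unfolding theta_1_2_2
    by (rule finite_subset[of _ "{(0,0), (0,1), (2,1), (3,1)} \<times> {(0,0), (0,1), (2,1), (3,1)}"]) auto
  show "finite (pverts (theta 1 2 2))"
    unfolding theta_1_2_2 by simp
qed (unfold theta_1_2_2(2), auto)

lemma pair_graph_F5: "pair_graph F5"
  by unfold_locales (auto simp: F5_def mk_symmetric_def symmetric_def sym_def)

lemma pair_graph_S_graph: "pair_graph (S_graph n k)"
proof
  show "finite (parcs (S_graph n k))"
    by (rule finite_subset[of _ "{0..<n} \<times> {0..<n}"]) (auto simp: S_graph_def)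
qed (auto simp: S_graph_def symmetric_def sym_def)

lemma pair_graph_S_plus_graph:
  assumes "k + 2 \<le> n"
  shows "pair_graph (S_plus_graph n k)"
proof
  show "finite (parcs (S_plus_graph n k))"
    by (rule finite_subset[of _ "{0..<n} \<times> {0..<n}"])
       (use assms in \<open>auto simp: S_plus_graph_def S_graph_def\<close>)
qed (use assms in \<open>auto simp: S_plus_graph_def S_graph_def symmetric_def sym_def\<close>)

lemma vertex_list:
  assumes "finite (pverts G)"
  shows "distinct (vertex_list G)" "set (vertex_list G) = pverts G"
    "length (vertex_list G) = card (pverts G)"
proof -
  have "\<exists>vs. distinct vs \<and> set vs = pverts G"
    using finite_distinct_list[OF assms] by blast
  from someI_ex[OF this] show *: "distinct (vertex_list G)" "set (vertex_list G) = pverts G"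
    by (auto simp: vertex_list_def)
  then show "length (vertex_list G) = card (pverts G)"
    by (metis distinct_card)
qed

text \<open>The spectrum does not depend on the order chosen for the vertices.\<close>

lemma eigenvalue_signless_laplacian_iff:
  assumes "pair_graph G"
  shows "eigenvalue (signless_laplacian G) k \<longleftrightarrow>
    (\<exists>x :: 'a \<Rightarrow> real. (\<exists>v \<in> pverts G. x v \<noteq> 0) \<and>
      (\<forall>v \<in> pverts G. real (out_degree G v) * x v
         + (\<Sum>w \<in> {w \<in> pverts G. (v, w) \<in> parcs G}. x w) = k * x v))"
  (is "_ \<longleftrightarrow> ?R")
proof -
  interpret pair_graph G by fact
  define n where "n = card (pverts G)"
  define vs where "vs = vertex_list G"
  note vl = vertex_list[OF pair_finite_verts, folded vs_def n_def]
  have bij: "bij_betw ((!) vs) {0..<n} (pverts G)"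
    using bij_betw_nth[OF vl(1), of "{0..<n}" "pverts G"] vl by (simp add: atLeast0LessThan)
  have verts: "pverts G = (!) vs ` {0..<n}"
    using bij by (simp add: bij_betw_def)
  have dims: "dim_row (signless_laplacian G) = n" "dim_col (signless_laplacian G) = n"
    by (simp_all add: signless_laplacian_def adjacency_matrix_def degree_matrix_def Let_def n_def)
  have sum_conv: "(\<Sum>w \<in> {w \<in> pverts G. (v, w) \<in> parcs G}. x w)
      = (\<Sum>j = 0..<n. if (v, vs ! j) \<in> parcs G then x (vs ! j) else 0)" for x :: "'a \<Rightarrow> real" and v
    by (simp add: sum.inter_filter pair_finite_verts
          sum.reindex_bij_betw[OF bij, of "\<lambda>w. if (v, w) \<in> parcs G then x w else 0"])
  have row_conv: "(signless_laplacian G *\<^sub>v vec n (\<lambda>i. x (vs ! i))) $ i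
      = real (out_degree G (vs ! i)) * x (vs ! i)
        + (\<Sum>w \<in> {w \<in> pverts G. (vs ! i, w) \<in> parcs G}. x w)"
    if "i < n" for i and x :: "'a \<Rightarrow> real"
  proof -
    have "(signless_laplacian G *\<^sub>v vec n (\<lambda>i. x (vs ! i))) $ i
        = (\<Sum>j = 0..<n. signless_laplacian G $$ (i, j) * x (vs ! j))"
      using that by (simp add: dims scalar_prod_def)
    also have "\<dots> = (\<Sum>j = 0..<n. (if i = j then real (out_degree G (vs ! i)) * x (vs ! i) else 0)
        + (if (vs ! i, vs ! j) \<in> parcs G then x (vs ! j) else 0))"
      using that by (intro sum.cong)
        (auto simp: signless_laplacian_def adjacency_matrix_def degree_matrix_def
           Let_def n_def vs_def distrib_right)
    also have "\<dots> = real (out_degree G (vs ! i)) * x (vs ! i)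
        + (\<Sum>w \<in> {w \<in> pverts G. (vs ! i, w) \<in> parcs G}. x w)"
      using that by (simp add: sum.distrib sum_conv)
    finally show ?thesis .
  qed
  have ev: "eigenvector (signless_laplacian G) (vec n (\<lambda>i. x (vs ! i))) k \<longleftrightarrow>
    (\<exists>v \<in> pverts G. x v \<noteq> 0) \<and>
      (\<forall>v \<in> pverts G. real (out_degree G v) * x v
         + (\<Sum>w \<in> {w \<in> pverts G. (v, w) \<in> parcs G}. x w) = k * x v)" for x :: "'a \<Rightarrow> real"
    unfolding eigenvector_def dims
    by (subst (1 2) vec_eq_iff) (auto simp: dims row_conv verts simp del: index_mult_mat_vec)
  have "\<exists>x :: 'a \<Rightarrow> real. u = vec n (\<lambda>i. x (vs ! i))" if "u \<in> carrier_vec n" for u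
    using that vl
    by (intro exI[of _ "\<lambda>v. u $ (THE i. i < n \<and> vs ! i = v)"] eq_vecI)
       (auto intro!: arg_cong[of _ _ "($) u"] the_equality[symmetric] simp: nth_eq_iff_index_eq)
  then have "eigenvalue (signless_laplacian G) k \<longleftrightarrow>
      (\<exists>x :: 'a \<Rightarrow> real. eigenvector (signless_laplacian G) (vec n (\<lambda>i. x (vs ! i))) k)"
    unfolding eigenvalue_def by (metis eigenvector_def dims(1))
  then show ?thesis by (simp only: ev)
qed

end

theory Submission
  imports Defs
begin

text \<open>
  The two forbidden subgraphs say exactly that triangles are vertex-disjoint. Collatz--Wielandt
  bounds (\<open>Q y \<le> n y\<close> for some positive vector \<open>y\<close>) then give \<open>q(G) \<le> n\<close>, except
  when some vertex of degree \<open>n - 1\<close> lies in a triangle, which forces \<open>G\<close> to be the graph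
  \<open>S\<close> obtained from a star by adding one edge; and \<open>q(S) > n\<close>. As \<open>y\<close> one takes the
  degree vector if every vertex in a triangle has degree at most \<open>n - 3\<close>, and a perturbed
  Perron vector of \<open>K\<^bsub>2,n-2\<^esub>\<close> if there is such a vertex of degree \<open>n - 2\<close>.
\<close>

section \<open>Isomorphisms and embeddings\<close>

lemma map_prod_in_image_iff:
  assumes "inj_on f V" "E \<subseteq> V \<times> V" "u \<in> V" "v \<in> V"
  shows "(f u, f v) \<in> map_prod f f ` E \<longleftrightarrow> (u, v) \<in> E"
proof -
  have "inj_on (map_prod f f) (V \<times> V)"
    using assms(1) by (simp add: map_prod_inj_on)
  then show ?thesis
    using inj_on_image_mem_iff[of "map_prod f f" "V \<times> V" "(u, v)" E] assms by simp
qed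

lemma (in pair_wf_digraph) parcs_subset: "parcs G \<subseteq> pverts G \<times> pverts G"
  by (auto dest: in_arcsD1 in_arcsD2)

text \<open>An arc here is the pair of its ends, so the arc part of an isomorphism is determined by
  its vertex part. This reduces \<open>digraph_iso\<close> to a vertex bijection that preserves and
  reflects adjacency.\<close>

lemma digraph_iso_pair_iff:
  assumes "pair_wf_digraph G" "pair_wf_digraph H"
  shows "digraph_iso G H \<longleftrightarrow>
    (\<exists>f. bij_betw f (pverts G) (pverts H) \<and>
      (\<forall>u \<in> pverts G. \<forall>v \<in> pverts G. (f u, f v) \<in> parcs H \<longleftrightarrow> (u, v) \<in> parcs G))"
    (is "_ \<longleftrightarrow> (\<exists>f. ?P f)")
proof
  interpret G: pair_wf_digraph G by fact
  interpret H: pair_wf_digraph H by fact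
  {
    assume "digraph_iso G H"
    then obtain h where h: "pre_digraph.digraph_isomorphism G h" and H: "with_proj H = app_iso h G"
      unfolding digraph_iso_def by blast
    have V: "pverts H = iso_verts h ` pverts G" and E: "parcs H = iso_arcs h ` parcs G"
      and tl: "iso_tail h = fst" and hd: "iso_head h = snd"
      using arg_cong[OF H, of verts] arg_cong[OF H, of arcs]
        arg_cong[OF H, of tail] arg_cong[OF H, of head] by simp_all
    have inj: "inj_on (iso_verts h) (pverts G)"
      using h by (simp add: pre_digraph.digraph_isomorphism_def)
    have arc: "iso_arcs h e = map_prod (iso_verts h) (iso_verts h) e" if "e \<in> parcs G" for e
      using h that by (auto simp: pre_digraph.digraph_isomorphism_def tl hd prod_eq_iff)
    have E': "parcs H = map_prod (iso_verts h) (iso_verts h) ` parcs G"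
      unfolding E using arc by (intro image_cong) auto
    have "?P (iso_verts h)"
      using inj V map_prod_in_image_iff[OF inj G.parcs_subset]
      unfolding E' by (simp add: bij_betw_def)
    then show "\<exists>f. ?P f" by (rule exI[of ?P])
  next
    assume "\<exists>f. ?P f"
    then obtain f where f: "?P f" ..
    \<comment> \<open>Head and tail must be \<open>snd\<close> and \<open>fst\<close>, since
      \<open>app_iso h G\<close> has to equal a \<open>with_proj\<close> graph.\<close>
    define h :: "('a, 'a \<times> 'a, 'b, 'b \<times> 'b) digraph_isomorphism"
      where "h = \<lparr>iso_verts = f, iso_arcs = map_prod f f, iso_head = snd, iso_tail = fst\<rparr>"
    have inj: "inj_on f (pverts G)" and V: "f ` pverts G = pverts H"
      using f by (auto simp: bij_betw_def)
    have "inj_on (map_prod f f) (parcs G)"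
      using map_prod_inj_on[OF inj inj] G.parcs_subset by (rule inj_on_subset)
    then have 1: "pre_digraph.digraph_isomorphism G h"
      using inj G.wf_digraph_axioms by (auto simp: pre_digraph.digraph_isomorphism_def h_def)
    have "parcs H \<subseteq> map_prod f f ` parcs G"
    proof
      fix e assume "e \<in> parcs H"
      moreover obtain s t where st: "e = (s, t)" by (cases e)
      ultimately have "s \<in> f ` pverts G" "t \<in> f ` pverts G" "(s, t) \<in> parcs H"
        unfolding V by (auto dest: H.in_arcsD1 H.in_arcsD2)
      then show "e \<in> map_prod f f ` parcs G"
        using f unfolding st by (auto intro!: rev_image_eqI)
    qed
    moreover have "map_prod f f ` parcs G \<subseteq> parcs H"
      using f by (auto dest: G.in_arcsD1 G.in_arcsD2)
    ultimately have "with_proj H = app_iso h G"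
      using V by (auto simp: app_iso_def h_def with_proj_def)
    with 1 show "digraph_iso G H"
      unfolding digraph_iso_def by blast
  }
qed

text \<open>The subgraph is the image of \<open>H\<close> under \<open>f\<close>. As subgraphs need
  not be induced, \<open>f\<close> only has to preserve arcs.\<close>

lemma contains_subgraphI:
  assumes "pair_wf_digraph G" "pair_wf_digraph H" "inj_on f (pverts H)"
    and verts: "f ` pverts H \<subseteq> pverts G"
    and arcs: "\<And>u v. (u, v) \<in> parcs H \<Longrightarrow> (f u, f v) \<in> parcs G"
  shows "contains_subgraph G H"
proof -
  interpret G: pair_wf_digraph G by fact
  interpret H: pair_wf_digraph H by fact
  define H' where "H' = \<lparr>pverts = f ` pverts H, parcs = map_prod f f ` parcs H\<rparr>"
  have wf: "pair_wf_digraph H'"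
    by unfold_locales (auto simp: H'_def dest: H.in_arcsD1 H.in_arcsD2)
  then have "subgraph H' G"
    using verts arcs G.wf_digraph_axioms
    by (auto simp: subgraph_def wf_digraph_wp_iff H'_def compatible_def)
  moreover have "digraph_iso H H'"
    unfolding digraph_iso_pair_iff[OF assms(2) wf]
    using assms(3) map_prod_in_image_iff[OF assms(3) H.parcs_subset]
    by (intro exI[of _ f]) (simp add: H'_def bij_betw_def)
  ultimately show ?thesis
    unfolding contains_subgraph_def by blast
qed

section \<open>Spectra\<close>

text \<open>\<open>q_index\<close> is a \<open>Max\<close> over real eigenvalues, so one must exist.
  A complex eigenvalue \<open>l\<close> exists, with eigenvector x + iy; symmetry equates x^T A y
  with y^T A x, which forces \<open>Im l\<close> = 0. Then x or y, whichever is nonzero, is a real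
  eigenvector.\<close>

lemma real_symmetric_spectrum_nonempty:
  fixes A :: "real mat"
  assumes A: "A \<in> carrier_mat n n" and n: "n > 0"
    and sym: "\<And>i j. i < n \<Longrightarrow> j < n \<Longrightarrow> A $$ (i, j) = A $$ (j, i)"
  shows "spectrum A \<noteq> {}"
proof -
  define C where "C = map_mat complex_of_real A"
  have C: "C \<in> carrier_mat n n" using A by (simp add: C_def)
  obtain l where "eigenvalue C l"
    using spectrum_non_empty[OF C n] by (auto simp: spectrum_def)
  then obtain v where v: "v \<in> carrier_vec n" "v \<noteq> 0\<^sub>v n" "C *\<^sub>v v = l \<cdot>\<^sub>v v"
    using C by (auto simp: eigenvalue_def eigenvector_def)
  define x y where "x i = Re (v $ i)" and "y i = Im (v $ i)" for i
  have row: "(\<Sum>j<n. complex_of_real (A $$ (i, j)) * v $ j) = l * v $ i" if "i < n" for i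
  proof -
    have "(\<Sum>j<n. complex_of_real (A $$ (i, j)) * v $ j) = (C *\<^sub>v v) $ i"
      using that A v(1) by (simp add: C_def scalar_prod_def atLeast0LessThan)
    then show ?thesis using that v by simp
  qed
  have re: "(\<Sum>j<n. A $$ (i, j) * x j) = Re l * x i - Im l * y i"
    and im: "(\<Sum>j<n. A $$ (i, j) * y j) = Im l * x i + Re l * y i" if "i < n" for i
    using arg_cong[OF row[OF that], of Re] arg_cong[OF row[OF that], of Im]
    by (simp_all add: x_def y_def)
  have "(\<Sum>i<n. x i * (\<Sum>j<n. A $$ (i, j) * y j)) = (\<Sum>i<n. \<Sum>j<n. A $$ (i, j) * x i * y j)"
    by (simp add: sum_distrib_left mult_ac)
  also have "\<dots> = (\<Sum>j<n. \<Sum>i<n. A $$ (j, i) * x i * y j)"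
    by (subst sum.swap) (simp add: sym)
  also have "\<dots> = (\<Sum>j<n. y j * (\<Sum>i<n. A $$ (j, i) * x i))"
    by (simp add: sum_distrib_left mult_ac)
  finally have "(\<Sum>i<n. x i * (Im l * x i + Re l * y i)) = (\<Sum>i<n. y i * (Re l * x i - Im l * y i))"
    by (simp add: re im)
  then have "(\<Sum>i<n. x i * (Im l * x i + Re l * y i) - y i * (Re l * x i - Im l * y i)) = 0"
    by (simp add: sum_subtractf)
  \<comment> \<open>The \<open>Re l\<close> terms cancel, leaving \<open>Im l\<close> times the
    squared norm of \<open>v\<close>.\<close>
  also have "(\<Sum>i<n. x i * (Im l * x i + Re l * y i) - y i * (Re l * x i - Im l * y i))
      = Im l * (\<Sum>i<n. (x i)\<^sup>2 + (y i)\<^sup>2)"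
    by (simp add: sum_distrib_left algebra_simps power2_eq_square)
  finally have prod: "Im l = 0 \<or> (\<Sum>i<n. (x i)\<^sup>2 + (y i)\<^sup>2) = 0" by simp
  obtain i where i: "i < n" "v $ i \<noteq> 0"
    using v(1,2) by (metis carrier_vecD eq_vecI index_zero_vec)
  have "(\<Sum>i<n. (x i)\<^sup>2 + (y i)\<^sup>2) \<noteq> 0"
    using i by (subst sum_nonneg_eq_0_iff) (auto simp: x_def y_def complex_eq_iff)
  with prod have Iml: "Im l = 0" by simp
  have ev: "eigenvalue A (Re l)" if z: "\<And>i. i < n \<Longrightarrow> (\<Sum>j<n. A $$ (i, j) * z j) = Re l * z i"
    and nz: "z i \<noteq> 0" for z
    unfolding eigenvalue_def eigenvector_def
  proof (intro exI conjI)
    show "vec n z \<in> carrier_vec (dim_row A)" using A by simp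
    show "vec n z \<noteq> 0\<^sub>v (dim_row A)"
      using i(1) nz A by (metis carrier_matD(1) index_vec index_zero_vec(1))
    show "A *\<^sub>v vec n z = Re l \<cdot>\<^sub>v vec n z"
      using A z by (intro eq_vecI) (auto simp: scalar_prod_def atLeast0LessThan)
  qed
  have "x i \<noteq> 0 \<or> y i \<noteq> 0"
    using i by (auto simp: x_def y_def complex_eq_iff)
  then have "eigenvalue A (Re l)"
    using ev[of x] ev[of y] re im Iml by auto
  then show ?thesis by (auto simp: spectrum_def)
qed

section \<open>Eigenvalue equations and weight vectors on the vertices\<close>

definition neighbours :: "'a pair_pre_digraph \<Rightarrow> 'a \<Rightarrow> 'a set" where
  "neighbours G v = {w \<in> pverts G. (v, w) \<in> parcs G}"

lemma signless_laplacian_carrier: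
  "signless_laplacian G \<in> carrier_mat (card (pverts G)) (card (pverts G))"
  by (auto simp: signless_laplacian_def adjacency_matrix_def degree_matrix_def Let_def)

lemma eigenvalue_le_q_index:
  assumes "eigenvalue (signless_laplacian G) k"
  shows "k \<le> q_index G"
  unfolding q_index_def using assms
  by (intro Max_ge card_finite_spectrum[OF signless_laplacian_carrier]) (simp add: spectrum_def)

context pair_graph
begin

lemma arc_sym: "(u, v) \<in> parcs G \<longleftrightarrow> (v, u) \<in> parcs G"
  using pair_sym_arcs by (auto simp: symmetric_def dest: symD)

lemma finite_neighbours [simp]: "finite (neighbours G v)"
  by (simp add: neighbours_def pair_finite_verts)

lemma neighbours_subset: "neighbours G v \<subseteq> pverts G"
  by (auto simp: neighbours_def)

lemma in_neighbours_iff [simp]: "w \<in> neighbours G v \<longleftrightarrow> (v, w) \<in> parcs G"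
  by (auto simp: neighbours_def dest: in_arcsD2)

lemma out_degree_eq_card: "out_degree G v = card (neighbours G v)"
proof -
  have "out_arcs G v = Pair v ` neighbours G v"
    by auto
  then show ?thesis
    by (simp add: out_degree_def card_image inj_on_def)
qed

text \<open>The degree term is spread over the incident edges, one copy of \<open>x v\<close> each,
  so that later estimates work edge by edge.\<close>

lemma eigenvalue_iff:
  "eigenvalue (signless_laplacian G) k \<longleftrightarrow>
    (\<exists>x. (\<exists>v \<in> pverts G. x v \<noteq> 0) \<and>
      (\<forall>v \<in> pverts G. (\<Sum>w \<in> neighbours G v. x v + x w) = k * x v))"
  unfolding eigenvalue_signless_laplacian_iff[OF pair_graph_axioms] neighbours_def[symmetric]
  by (simp add: sum.distrib out_degree_eq_card)

lemma spectrum_nonempty: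
  assumes "pverts G \<noteq> {}"
  shows "spectrum (signless_laplacian G) \<noteq> {}"
proof (rule real_symmetric_spectrum_nonempty[OF signless_laplacian_carrier])
  show "card (pverts G) > 0"
    using assms by (simp add: card_gt_0_iff pair_finite_verts)
qed (auto simp: signless_laplacian_def adjacency_matrix_def degree_matrix_def Let_def arc_sym)

text \<open>Collatz-Wielandt bound. For an eigenvector \<open>x\<close>, take the vertex
  \<open>v\<close> where the ratio of absolute value of \<open>x\<close> to \<open>y\<close> is
  largest; there the eigenvalue equation, the triangle inequality and \<open>le\<close> bound the
  eigenvalue by \<open>k\<close>.\<close>

lemma q_index_le:
  assumes ne: "pverts G \<noteq> {}" and pos: "\<And>v. v \<in> pverts G \<Longrightarrow> 0 < y v"
    and le: "\<And>v. v \<in> pverts G \<Longrightarrow> (\<Sum>w \<in> neighbours G v. y v + y w) \<le> k * y v"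
  shows "q_index G \<le> k"
proof -
  have "l \<le> k" if "eigenvalue (signless_laplacian G) l" for l
  proof -
    from that obtain x where "\<exists>v \<in> pverts G. x v \<noteq> 0"
      and "\<forall>v \<in> pverts G. (\<Sum>w \<in> neighbours G v. x v + x w) = l * x v"
      unfolding eigenvalue_iff by auto
    then obtain u where x: "\<And>v. v \<in> pverts G \<Longrightarrow> (\<Sum>w \<in> neighbours G v. x v + x w) = l * x v"
      and u: "u \<in> pverts G" "x u \<noteq> 0"
      by auto
    define r where "r v = \<bar>x v\<bar> / y v" for v
    have "Max (r ` pverts G) \<in> r ` pverts G"
      using ne by (intro Max_in) (auto simp: pair_finite_verts)
    then obtain v where v: "v \<in> pverts G" "r v = Max (r ` pverts G)"
      by auto
    have max: "r w \<le> r v" if "w \<in> pverts G" for w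
      unfolding v(2) using that by (intro Max_ge) (auto simp: pair_finite_verts)
    have xle: "\<bar>x w\<bar> \<le> r v * y w" if "w \<in> pverts G" for w
      using max[OF that] pos[OF that] by (simp add: r_def[of w] field_simps)
    have xv: "\<bar>x v\<bar> = r v * y v"
      using pos[OF v(1)] by (simp add: r_def)
    \<comment> \<open>A nonzero entry makes the maximal ratio positive, so it can be cancelled at
      the end.\<close>
    have "0 < r u" using u pos[OF u(1)] by (simp add: r_def)
    then have "0 < r v" using max[OF u(1)] by simp
    have "l * \<bar>x v\<bar> \<le> \<bar>l * x v\<bar>"
      by (simp add: abs_mult mult_right_mono)
    also have "\<dots> = \<bar>\<Sum>w \<in> neighbours G v. x v + x w\<bar>"
      using x[OF v(1)] by simp
    also have "\<dots> \<le> (\<Sum>w \<in> neighbours G v. r v * (y v + y w))"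
    proof (rule order_trans[OF sum_abs sum_mono])
      fix w assume "w \<in> neighbours G v"
      then have "w \<in> pverts G" by (simp add: neighbours_def)
      then show "\<bar>x v + x w\<bar> \<le> r v * (y v + y w)"
        using xle[of w] xv by (simp add: distrib_left)
    qed
    also have "\<dots> = r v * (\<Sum>w \<in> neighbours G v. y v + y w)"
      by (rule sum_distrib_left[symmetric])
    also have "\<dots> \<le> r v * (k * y v)"
      using le[OF v(1)] \<open>0 < r v\<close> by simp
    also have "\<dots> = k * \<bar>x v\<bar>"
      by (simp add: xv)
    finally show "l \<le> k"
      using \<open>0 < r v\<close> pos[OF v(1)] by (simp add: xv)
  qed
  then show ?thesis
    unfolding q_index_def using spectrum_nonempty[OF ne]
    by (subst Max_le_iff[OF card_finite_spectrum(1)[OF signless_laplacian_carrier]])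
      (auto simp: spectrum_def)
qed

end

text \<open>Eigenvectors pull back along the vertex bijection; doing this in both directions gives
  equal spectra.\<close>

lemma q_index_digraph_iso:
  assumes G: "pair_graph G" and H: "pair_graph H" and iso: "digraph_iso G H"
  shows "q_index G = q_index H"
proof -
  \<comment> \<open>Stated for fresh graphs and vertex types, so that it applies to the pair in
    either order.\<close>
  have ev: "eigenvalue (signless_laplacian G) k"
    if G: "pair_graph G" and H: "pair_graph H" and iso: "digraph_iso G H"
      and k: "eigenvalue (signless_laplacian H) k"
    for G :: "'c pair_pre_digraph" and H :: "'d pair_pre_digraph" and k
  proof -
    interpret G: pair_graph G by fact
    interpret H: pair_graph H by fact
    obtain f where f: "bij_betw f (pverts G) (pverts H)"
      and arc: "\<And>u v. u \<in> pverts G \<Longrightarrow> v \<in> pverts G \<Longrightarrow> (f u, f v) \<in> parcs H \<longleftrightarrow> (u, v) \<in> parcs G"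
      using iso digraph_iso_pair_iff[OF G.pair_wf_digraph H.pair_wf_digraph] by blast
    have V: "pverts H = f ` pverts G" and inj: "inj_on f (pverts G)"
      using f by (auto simp: bij_betw_def)
    have nb: "neighbours H (f v) = f ` neighbours G v" if "v \<in> pverts G" for v
      using that arc unfolding neighbours_def V by auto
    have inj': "inj_on f (neighbours G v)" for v
      using inj by (rule inj_on_subset) (auto simp: neighbours_def)
    obtain x where x: "\<exists>v \<in> pverts H. x v \<noteq> 0"
      "\<And>v. v \<in> pverts H \<Longrightarrow> (\<Sum>w \<in> neighbours H v. x v + x w) = k * x v"
      using k unfolding H.eigenvalue_iff by blast
    show ?thesis
      unfolding G.eigenvalue_iff
    proof (intro exI[of _ "x \<circ> f"] conjI ballI)
      show "\<exists>v\<in>pverts G. (x \<circ> f) v \<noteq> 0" using x(1) V by auto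
      fix v assume v: "v \<in> pverts G"
      then show "(\<Sum>w\<in>neighbours G v. (x \<circ> f) v + (x \<circ> f) w) = k * (x \<circ> f) v"
        using x(2)[of "f v"] by (simp add: V nb sum.reindex[OF inj'])
    qed
  qed
  interpret G: pair_graph G by fact
  have "digraph_iso H G"
    using digraph_iso_swap[OF _ iso] G.wf_digraph_axioms by blast
  then have "spectrum (signless_laplacian G) = spectrum (signless_laplacian H)"
    using ev[OF G H iso] ev[OF H G] by (auto simp: spectrum_def)
  then show ?thesis by (simp add: q_index_def)
qed

section \<open>The extremal graph\<close>

text \<open>An eigenvector constant on the three classes (centre, two triangle vertices, leaves)
  reduces the eigenvalue equation to a cubic, which changes sign between n and n + 1.\<close>

lemma card_le_q_index_S_plus:
  assumes n: "n \<ge> 4"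
  shows "real n < q_index (S_plus_graph n 1)"
proof -
  define N where "N = real n"
  have N: "N \<ge> 4" using n by (simp add: N_def)
  interpret pair_graph "S_plus_graph n 1"
    using pair_graph_S_plus_graph[of 1 n] n by simp
  \<comment> \<open>With centre weight (q-1)(q-3), the leaf and triangle equations force the weights
    q-3 and q-1. The centre equation then reads \<open>p q = 0\<close>.\<close>
  define p where "p q = (q - (N - 1)) * (q - 3) * (q - 1) - 2 * (q - 1) - (N - 3) * (q - 3)" for q :: real
  have pN: "p N = -4"
    by (simp add: p_def algebra_simps)
  have "p (N + 1) = (N - 3) * (N + 2)"
    by (simp add: p_def algebra_simps)
  also have "\<dots> \<ge> 0" using N by simp
  finally have "\<exists>q. N \<le> q \<and> q \<le> N + 1 \<and> p q = 0"
    using pN by (intro IVT') (auto simp: p_def intro!: continuous_intros)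
  then obtain q where q: "N \<le> q" "p q = 0" by blast
  \<comment> \<open>The root is not \<open>N\<close> itself, because \<open>p N\<close> is -4; this
    makes the final inequality strict.\<close>
  with pN have "N < q" by (cases "q = N") auto
  define x :: "nat \<Rightarrow> real" where
    "x i = (if i = 0 then (q - 1) * (q - 3) else if i < 3 then q - 1 else q - 3)" for i
  have V: "pverts (S_plus_graph n 1) = {0..<n}"
    by (simp add: S_plus_graph_def S_graph_def)
  have nb0: "neighbours (S_plus_graph n 1) 0 = {1, 2} \<union> {3..<n}"
    and nb1: "neighbours (S_plus_graph n 1) 1 = {0, 2}"
    and nb2: "neighbours (S_plus_graph n 1) 2 = {0, 1}"
    using n by (auto simp: neighbours_def S_plus_graph_def S_graph_def)
  have nbi: "neighbours (S_plus_graph n 1) i = {0}" if "i < n" "i \<ge> 3" for i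
    using that by (auto simp: neighbours_def S_plus_graph_def S_graph_def)
  have "eigenvalue (signless_laplacian (S_plus_graph n 1)) q"
    unfolding eigenvalue_iff
  proof (intro exI[of _ x] conjI ballI)
    have "x 0 \<noteq> 0" using \<open>N < q\<close> N by (simp add: x_def)
    then show "\<exists>v\<in>pverts (S_plus_graph n 1). x v \<noteq> 0"
      using n unfolding V by (intro bexI[of _ 0]) auto
    fix i assume "i \<in> pverts (S_plus_graph n 1)"
    then have i: "i < n" unfolding V by simp
    consider "i = 0" | "i = 1" | "i = 2" | "i \<ge> 3" by linarith
    then show "(\<Sum>j\<in>neighbours (S_plus_graph n 1) i. x i + x j) = q * x i"
    proof cases
      case 1
      have "(\<Sum>j\<in>{3..<n}. x 0 + x j) = (\<Sum>j\<in>{3..<n}. (q - 1) * (q - 3) + (q - 3))"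
        by (intro sum.cong) (auto simp: x_def)
      also have "\<dots> = (N - 3) * ((q - 1) * (q - 3) + (q - 3))"
        using n by (simp add: N_def of_nat_diff)
      finally have "(\<Sum>j\<in>neighbours (S_plus_graph n 1) 0. x 0 + x j)
          = 2 * ((q - 1) * (q - 3) + (q - 1)) + (N - 3) * ((q - 1) * (q - 3) + (q - 3))"
        unfolding nb0 by (subst sum.union_disjoint) (auto simp: x_def)
      also have "\<dots> = q * x 0 - p q"
        by (simp add: x_def p_def algebra_simps)
      finally show ?thesis using 1 q(2) by simp
    next
      case 2
      then show ?thesis by (simp only: nb1) (simp add: x_def algebra_simps)
    next
      case 3
      then show ?thesis by (simp only: nb2) (simp add: x_def algebra_simps)
    next
      case 4
      then show ?thesis by (simp only: nbi[OF i]) (simp add: x_def algebra_simps)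
    qed
  qed
  from eigenvalue_le_q_index[OF this] show ?thesis
    using \<open>N < q\<close> by (simp add: N_def)
qed

text \<open>Adjacency depends only on which of \<open>v\<close>, \<open>a\<close>, \<open>b\<close>
  the ends are, so \<open>v\<close>, \<open>a\<close>, \<open>b\<close> go to 0, 1, 2 and the
  remaining vertices to \<open>{3..<n}\<close> in any order.\<close>

lemma (in pair_graph) digraph_iso_S_plus:
  assumes v: "v \<in> pverts G" "a \<in> pverts G" "b \<in> pverts G" "a \<noteq> v" "b \<noteq> v" "a \<noteq> b"
    and arcs: "\<And>s t. s \<in> pverts G \<Longrightarrow> t \<in> pverts G \<Longrightarrow>
      (s, t) \<in> parcs G \<longleftrightarrow> s \<noteq> t \<and> (s = v \<or> t = v \<or> {s, t} = {a, b})"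
  shows "digraph_iso G (S_plus_graph (card (pverts G)) 1)"
proof -
  define n where "n = card (pverts G)"
  have "card {v, a, b} = 3" using v by simp
  then have n: "n \<ge> 3" and card: "card (pverts G - {v, a, b}) = n - 3"
    using v card_mono[OF pair_finite_verts, of "{v, a, b}"]
    by (simp_all add: n_def card_Diff_subset)
  then interpret S: pair_graph "S_plus_graph n 1"
    using pair_graph_S_plus_graph[of 1 n] by simp
  obtain h where h: "bij_betw h (pverts G - {v, a, b}) {3..<n}"
    using finite_same_card_bij[of "pverts G - {v, a, b}" "{3..<n}"] card pair_finite_verts by auto
  define f where "f = h(v := 0, a := 1, b := 2)"
  have "bij_betw f (pverts G - {v, a, b}) {3..<n}"
    using h by (rule bij_betw_cong[THEN iffD1, rotated]) (auto simp: f_def)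
  moreover have "bij_betw f {v, a, b} {0, 1, 2}"
    using v by (auto simp: bij_betw_def f_def)
  ultimately have "bij_betw f ((pverts G - {v, a, b}) \<union> {v, a, b}) ({3..<n} \<union> {0, 1, 2})"
    by (rule bij_betw_combine) auto
  moreover have "(pverts G - {v, a, b}) \<union> {v, a, b} = pverts G" "{3..<n} \<union> {0, 1, 2} = {0..<n}"
    using v n by auto
  ultimately have f: "bij_betw f (pverts G) {0..<n}" by simp
  have f_v: "f v = 0" "f a = 1" "f b = 2"
    using v by (auto simp: f_def)
  have eq: "f s = f t \<longleftrightarrow> s = t" if "s \<in> pverts G" "t \<in> pverts G" for s t
    using f that by (auto simp: bij_betw_def dest: inj_onD)
  show ?thesis
    unfolding n_def[symmetric] digraph_iso_pair_iff[OF pair_wf_digraph S.pair_wf_digraph]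
  proof (intro exI[of _ f] conjI ballI)
    show "bij_betw f (pverts G) (pverts (S_plus_graph n 1))"
      using f by (simp add: S_plus_graph_def S_graph_def)
    fix s t assume st: "s \<in> pverts G" "t \<in> pverts G"
    have "f s = 0 \<longleftrightarrow> s = v" "f s = 1 \<longleftrightarrow> s = a" "f s = 2 \<longleftrightarrow> s = b"
      "f t = 0 \<longleftrightarrow> t = v" "f t = 1 \<longleftrightarrow> t = a" "f t = 2 \<longleftrightarrow> t = b"
      using eq[OF st(1) v(1)] eq[OF st(1) v(2)] eq[OF st(1) v(3)]
        eq[OF st(2) v(1)] eq[OF st(2) v(2)] eq[OF st(2) v(3)] by (simp_all add: f_v)
    moreover have "f s < n" "f t < n"
      using f st by (auto simp: bij_betw_def)
    moreover have "(i, j) \<in> parcs (S_plus_graph n 1) \<longleftrightarrow>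
        i \<noteq> j \<and> (i = 0 \<or> j = 0 \<or> i = 1 \<and> j = 2 \<or> i = 2 \<and> j = 1)" if "i < n" "j < n" for i j
      using that by (auto simp: S_plus_graph_def S_graph_def)
    ultimately show "(f s, f t) \<in> parcs (S_plus_graph n 1) \<longleftrightarrow> (s, t) \<in> parcs G"
      using arcs[OF st] eq[OF st] v by (auto simp: doubleton_eq_iff)
  qed
qed

section \<open>Graphs with disjoint triangles\<close>

text \<open>Double counting of the walks of length two from \<open>v\<close>: by their middle vertex
  \<open>w\<close> and by their last vertex \<open>z\<close>.\<close>

lemma (in pair_graph) sum_degree_neighbours:
  "(\<Sum>w \<in> neighbours G v. card (neighbours G w))
    = (\<Sum>z \<in> pverts G. card (neighbours G z \<inter> neighbours G v))"
proof -
  have "(\<Sum>w \<in> neighbours G v. card (neighbours G w))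
      = (\<Sum>w \<in> neighbours G v. \<Sum>z \<in> pverts G. if (w, z) \<in> parcs G then 1 else 0)"
    by (simp add: neighbours_def sum.If_cases pair_finite_verts Int_def)
  also have "\<dots> = (\<Sum>z \<in> pverts G. \<Sum>w \<in> neighbours G v. if (w, z) \<in> parcs G then 1 else 0)"
    by (rule sum.swap)
  also have "\<dots> = (\<Sum>z \<in> pverts G. card (neighbours G z \<inter> neighbours G v))"
  proof (rule sum.cong[OF refl])
    fix z assume "z \<in> pverts G"
    have "neighbours G z \<inter> neighbours G v = {w \<in> neighbours G v. (w, z) \<in> parcs G}"
      using arc_sym by auto
    then show "(\<Sum>w \<in> neighbours G v. if (w, z) \<in> parcs G then 1 else 0)
        = card (neighbours G z \<inter> neighbours G v)"
      by (simp add: sum.If_cases Int_def)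
  qed
  finally show ?thesis .
qed

text \<open>The walks are split by their end: back at \<open>v\<close> (one per neighbour), at a
  neighbour of \<open>v\<close> (closing a triangle), or at one of the remaining vertices, each
  reached at most \<open>k\<close> times.\<close>

lemma (in pair_graph) sum_degree_neighbours_le:
  assumes v: "v \<in> pverts G"
    and apart: "\<And>z. z \<in> pverts G \<Longrightarrow> z \<noteq> v \<Longrightarrow> (v, z) \<notin> parcs G \<Longrightarrow>
      card (neighbours G z \<inter> neighbours G v) \<le> k"
  shows "(\<Sum>w \<in> neighbours G v. card (neighbours G w)) \<le>
    card (neighbours G v) + (\<Sum>z \<in> neighbours G v. card (neighbours G z \<inter> neighbours G v))
      + (card (pverts G) - 1 - card (neighbours G v)) * k"
proof -
  define g where "g z = card (neighbours G z \<inter> neighbours G v)" for z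
  define R where "R = pverts G - insert v (neighbours G v)"
  have vn: "v \<notin> neighbours G v" using no_loops' by auto
  have sub: "insert v (neighbours G v) \<subseteq> pverts G" using v by (auto simp: neighbours_def)
  have "sum g (pverts G) = sum g R + sum g (insert v (neighbours G v))"
    unfolding R_def using sub pair_finite_verts by (rule sum.subset_diff)
  also have "sum g (insert v (neighbours G v)) = card (neighbours G v) + sum g (neighbours G v)"
    using vn by (simp add: g_def)
  also have "sum g R \<le> card R * k"
    using sum_bounded_above[of R g k] apart by (auto simp: R_def g_def)
  also have "card R = card (pverts G) - 1 - card (neighbours G v)"
    unfolding R_def using sub vn by (simp add: card_Diff_subset)
  finally show ?thesis
    unfolding sum_degree_neighbours g_def by simp
qed

text \<open>Two different apexes over the edge \<open>uv\<close> would give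
  \<open>theta 1 2 2\<close> with \<open>u\<close>, \<open>v\<close> as the ends of the three
  paths.\<close>

lemma (in pair_graph) unique_apex:
  assumes "\<not> contains_subgraph G (theta 1 2 2)"
    and "(u, v) \<in> parcs G" "(u, x) \<in> parcs G" "(v, x) \<in> parcs G"
      "(u, y) \<in> parcs G" "(v, y) \<in> parcs G"
  shows "x = y"
proof (rule ccontr)
  assume "x \<noteq> y"
  note no_loops'[OF assms(2)] no_loops'[OF assms(3)] no_loops'[OF assms(4)]
    no_loops'[OF assms(5)] no_loops'[OF assms(6)]
  then have distinct: "distinct [u, v, x, y]" using \<open>x \<noteq> y\<close> by simp
  interpret T: pair_graph "theta 1 2 2" by (rule pair_graph_theta_1_2_2)
  define f where "f p = (if p = (0, 0) then u else if p = (0, 1) then v else if p = (2, 1) then x else y)"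
    for p :: "nat \<times> nat"
  have "contains_subgraph G (theta 1 2 2)"
  proof (rule contains_subgraphI[of _ _ f])
    show "inj_on f (pverts (theta 1 2 2))"
      using distinct unfolding theta_1_2_2(1) by (auto simp: f_def)
    show "f ` pverts (theta 1 2 2) \<subseteq> pverts G"
      using assms(2-) unfolding theta_1_2_2(1) by (auto simp: f_def dest: in_arcsD1 in_arcsD2)
    show "(f p, f q) \<in> parcs G" if "(p, q) \<in> parcs (theta 1 2 2)" for p q
      using that assms(2-) arc_sym unfolding theta_1_2_2 by (auto simp: f_def)
  qed (fact pair_wf_digraph T.pair_wf_digraph)+
  with assms(1) show False by contradiction
qed

section \<open>Graphs with neither forbidden subgraph\<close>

locale disjoint_triangles = pair_graph +
  assumes no_theta: "\<not> contains_subgraph G (theta 1 2 2)"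
    and no_F5: "\<not> contains_subgraph G F5"
begin

text \<open>Two triangles at \<open>v\<close> that share a second vertex coincide by
  \<open>unique_apex\<close>; if they share only \<open>v\<close>, they form
  \<open>F5\<close>.\<close>

lemma unique_triangle:
  assumes e: "(v, a) \<in> parcs G" "(v, b) \<in> parcs G" "(a, b) \<in> parcs G"
    "(v, c) \<in> parcs G" "(v, d) \<in> parcs G" "(c, d) \<in> parcs G"
  shows "c = a \<and> d = b \<or> c = b \<and> d = a"
proof (rule ccontr)
  assume neq: "\<not> (c = a \<and> d = b \<or> c = b \<and> d = a)"
  note apex = unique_apex[OF no_theta]
  have "c \<noteq> a" "c \<noteq> b" "d \<noteq> a" "d \<noteq> b"
    using neq e apex[OF e(1) e(2,3)] apex[OF e(2) e(1)] arc_sym by blast+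
  moreover note no_loops'[OF e(1)] no_loops'[OF e(2)] no_loops'[OF e(3)] no_loops'[OF e(4)]
    no_loops'[OF e(5)] no_loops'[OF e(6)]
  ultimately have distinct: "distinct [v, a, b, c, d]" by simp
  interpret F: pair_graph F5 by (rule pair_graph_F5)
  have F5: "pverts F5 = {0, 1, 2, 3, 4}"
    "parcs F5 = {(0, 1), (1, 2), (0, 2), (0, 3), (3, 4), (0, 4),
      (1, 0), (2, 1), (2, 0), (3, 0), (4, 3), (4, 0)}"
    by (auto simp: F5_def mk_symmetric_def)
  define f where "f i = [v, a, b, c, d] ! i" for i
  have f: "f 0 = v" "f 1 = a" "f 2 = b" "f 3 = c" "f 4 = d"
    by (simp_all add: f_def)
  have "contains_subgraph G F5"
  proof (rule contains_subgraphI[of _ _ f])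
    show "inj_on f (pverts F5)"
      using distinct by (simp add: F5 f[simplified])
    show "f ` pverts F5 \<subseteq> pverts G"
      using e by (auto simp: F5 f[simplified] dest: in_arcsD1 in_arcsD2)
    show "(f i, f j) \<in> parcs G" if "(i, j) \<in> parcs F5" for i j
      using that e arc_sym unfolding F5 by (auto simp: f[simplified])
  qed (fact pair_wf_digraph F.pair_wf_digraph)+
  with no_F5 show False by contradiction
qed

text \<open>This is the inequality needed for \<open>q_index_le\<close> with the degree vector as
  weights and k = n. Without a triangle at \<open>v\<close>, the walks number at most d + (n-1-d)d.
  A triangle adds two walks, but every non-neighbour of \<open>v\<close> then loses at least one,
  and \<open>deg\<close> provides at least two non-neighbours.\<close>

lemma sum_degree_le:
  assumes v: "v \<in> pverts G"
    and deg: "\<And>a b. (v, a) \<in> parcs G \<Longrightarrow> (v, b) \<in> parcs G \<Longrightarrow> (a, b) \<in> parcs G \<Longrightarrow>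
      card (neighbours G v) + 3 \<le> card (pverts G)"
  shows "(\<Sum>w \<in> neighbours G v. card (neighbours G v) + card (neighbours G w))
    \<le> card (pverts G) * card (neighbours G v)"
proof -
  define d where "d = card (neighbours G v)"
  have "d < card (pverts G)"
    unfolding d_def using v no_loops'
    by (intro psubset_card_mono pair_finite_verts) (auto simp: neighbours_def)
  \<comment> \<open>\<open>r\<close> counts the non-neighbours of \<open>v\<close> other than
    \<open>v\<close> itself.\<close>
  then obtain r where r: "card (pverts G) = d + 1 + r"
    by (metis less_iff_Suc_add Suc_eq_plus1 add.commute add.assoc)
  have "(\<Sum>w \<in> neighbours G v. card (neighbours G w)) \<le> d + r * d"
  proof (cases "\<exists>a b. (v, a) \<in> parcs G \<and> (v, b) \<in> parcs G \<and> (a, b) \<in> parcs G")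
    case False
    have "(\<Sum>w \<in> neighbours G v. card (neighbours G w)) \<le>
        d + (\<Sum>z \<in> neighbours G v. card (neighbours G z \<inter> neighbours G v)) + r * d"
      using sum_degree_neighbours_le[OF v, of d] r
      by (simp add: d_def card_mono)
    moreover have "neighbours G z \<inter> neighbours G v = {}" if "z \<in> neighbours G v" for z
      using False that by auto
    ultimately show ?thesis by simp
  next
    case True
    then obtain a b where ab: "(v, a) \<in> parcs G" "(v, b) \<in> parcs G" "(a, b) \<in> parcs G" by blast
    have "a \<noteq> b" using no_loops'[OF ab(3)] .
    define g where "g z = card (neighbours G z \<inter> neighbours G v)" for z
    have "d \<ge> 2"
      using card_mono[of "neighbours G v" "{a, b}"] ab \<open>a \<noteq> b\<close> by (simp add: d_def)
    then obtain e where e: "d = e + 1" by (cases d) auto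
    have "r \<ge> 2" using deg[OF ab] r by (simp add: d_def)
    have "(\<Sum>w \<in> neighbours G v. card (neighbours G w)) \<le> d + sum g (neighbours G v) + r * e"
      unfolding g_def d_def
    proof (rule sum_degree_neighbours_le[OF v, of e, THEN order_trans])
      fix z assume z: "z \<in> pverts G" "z \<noteq> v" "(v, z) \<notin> parcs G"
      \<comment> \<open>Otherwise \<open>z\<close> would be a second apex over the edge
        \<open>ab\<close>, besides \<open>v\<close>.\<close>
      have "\<not> ((z, a) \<in> parcs G \<and> (z, b) \<in> parcs G)"
        using unique_apex[OF no_theta ab(3), of v z] z ab arc_sym by blast
      then have "neighbours G z \<inter> neighbours G v \<subset> neighbours G v"
        using ab by auto
      then have "card (neighbours G z \<inter> neighbours G v) < d"
        unfolding d_def by (intro psubset_card_mono) auto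
      then show "card (neighbours G z \<inter> neighbours G v) \<le> e" using e by simp
    qed (use r in \<open>simp add: d_def\<close>)
    \<comment> \<open>Only the walks v-a-b and v-b-a can end at a neighbour of
      \<open>v\<close>.\<close>
    moreover have "sum g (neighbours G v) \<le> 2"
    proof -
      have tri: "s = a \<and> t = b \<or> s = b \<and> t = a"
        if "(v, s) \<in> parcs G" "(s, t) \<in> parcs G" "(v, t) \<in> parcs G" for s t
        using unique_triangle[OF ab that(1,3,2)] .
      have "neighbours G z \<inter> neighbours G v = {}" if "z \<in> neighbours G v - {a, b}" for z
        using tri[of z] that by auto
      then have "sum g (neighbours G v) = sum g {a, b}"
        using ab by (intro sum.mono_neutral_right) (auto simp: g_def)
      moreover have "neighbours G a \<inter> neighbours G v \<subseteq> {b}" "neighbours G b \<inter> neighbours G v \<subseteq> {a}"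
        using tri[OF ab(1)] tri[OF ab(2)] \<open>a \<noteq> b\<close> by auto
      then have "g a \<le> 1" "g b \<le> 1"
        unfolding g_def using card_mono[of "{b}"] card_mono[of "{a}"] by auto
      ultimately show ?thesis using \<open>a \<noteq> b\<close> by simp
    qed
    ultimately show ?thesis using \<open>r \<ge> 2\<close> e by simp
  qed
  then show ?thesis
    by (simp add: sum.distrib r d_def[symmetric] algebra_simps)
qed

lemma q_index_le_card:
  assumes ne: "pverts G \<noteq> {}"
    and deg: "\<And>v a b. (v, a) \<in> parcs G \<Longrightarrow> (v, b) \<in> parcs G \<Longrightarrow> (a, b) \<in> parcs G \<Longrightarrow>
      card (neighbours G v) + 3 \<le> card (pverts G)"
  shows "q_index G \<le> card (pverts G)"
proof (rule q_index_le[OF ne])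
  \<comment> \<open>An isolated vertex gets weight 1, since the weights must be positive.\<close>
  define y where "y v = real (max 1 (card (neighbours G v)))" for v
  fix v assume v: "v \<in> pverts G"
  show "y v > 0" by (simp add: y_def)
  have y: "y s = card (neighbours G s)" if "(s, t) \<in> parcs G" for s t
  proof -
    have "card (neighbours G s) > 0"
      using that by (auto simp: card_gt_0_iff)
    then show ?thesis by (simp add: y_def)
  qed
  show "(\<Sum>w \<in> neighbours G v. y v + y w) \<le> card (pverts G) * y v"
  proof (cases "neighbours G v = {}")
    case True
    then show ?thesis by (simp add: y_def)
  next
    case False
    then have yv: "y v = card (neighbours G v)" using y by auto
    have "y w = card (neighbours G w)" if "w \<in> neighbours G v" for w
      using that y arc_sym by auto
    then have "(\<Sum>w \<in> neighbours G v. y v + y w)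
        = real (\<Sum>w \<in> neighbours G v. card (neighbours G v) + card (neighbours G w))"
      by (simp add: yv)
    also have "\<dots> \<le> real (card (pverts G) * card (neighbours G v))"
      by (intro of_nat_mono sum_degree_le v) (rule deg)
    finally show ?thesis by (simp add: yv)
  qed
qed

text \<open>Here \<open>v\<close> has a single non-neighbour \<open>w\<close>, too few for the count
  with degrees. The graph is close to a complete bipartite graph with poles \<open>v\<close>,
  \<open>w\<close>, and the weights are adapted to that.\<close>

lemma q_index_le_card_near_dominating:
  assumes n: "card (pverts G) \<ge> 6"
    and v: "card (neighbours G v) + 2 = card (pverts G)"
    and ab: "(v, a) \<in> parcs G" "(v, b) \<in> parcs G" "(a, b) \<in> parcs G"
  shows "q_index G \<le> card (pverts G)"
proof -
  define m where "m = real (card (neighbours G v))"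
  have m: "real (card (pverts G)) = m + 2" "m \<ge> 4"
    using n v by (simp_all add: m_def flip: v)
  have vV: "v \<in> pverts G" using ab(1) by (rule in_arcsD1)
  have vn: "v \<notin> neighbours G v" using no_loops' by auto
  have "card (pverts G - insert v (neighbours G v)) = 1"
    using vV vn v by (subst card_Diff_subset) (auto simp: neighbours_def)
  then obtain w where w: "pverts G - insert v (neighbours G v) = {w}"
    by (auto simp: card_1_singleton_iff)
  have V: "pverts G = insert v (insert w (neighbours G v))"
    and wv: "w \<noteq> v" "(v, w) \<notin> parcs G"
    using w vV by (auto simp: neighbours_def)
  have arc_v: "(v, t) \<in> parcs G" if "(s, t) \<in> parcs G" "t \<noteq> v" "t \<noteq> w" for s t
    using in_arcsD2[OF that(1)] that(2,3) unfolding V by simp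
  \<comment> \<open>\<open>w\<close> misses \<open>a\<close> or \<open>b\<close>, as otherwise
    \<open>v\<close> and \<open>w\<close> were two apexes over \<open>ab\<close>. By symmetry it is
    \<open>b\<close>, and the weights below exploit this.\<close>
  have main: "q_index G \<le> card (pverts G)"
    if ab: "(v, a) \<in> parcs G" "(v, b) \<in> parcs G" "(a, b) \<in> parcs G" and bw: "(b, w) \<notin> parcs G" for a b
  proof (rule q_index_le)
    have neq: "a \<noteq> b" "a \<noteq> v" "b \<noteq> v" "a \<noteq> w" "b \<noteq> w"
      using ab wv no_loops' by auto
    \<comment> \<open>The Perron vector of the complete bipartite graph with parts of sizes 2 and m
      is 3m, 3m on the poles and 6 elsewhere. Weight m is moved from \<open>w\<close> to
      \<open>v\<close>, keeping the pole sum 6m and hence equality at ordinary vertices, and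
      \<open>a\<close>, \<open>b\<close> are raised to absorb the edge \<open>ab\<close>.\<close>
    define y where "y z = (if z = v then 4 * m else if z = w then 2 * m
      else if z = a then 12 else if z = b then 7 else 6)" for z
    have y_simps: "y v = 4 * m" "y w = 2 * m" "y a = 12" "y b = 7"
      using neq wv by (auto simp: y_def)
    have y_pos: "y z > 0" for z using m by (simp add: y_def)
    show "pverts G \<noteq> {}" using vV by auto
    show "y z > 0" for z by (rule y_pos)
    \<comment> \<open>As the weights are positive, each neighbourhood may be replaced by a larger
      set.\<close>
    have sub: "(\<Sum>t \<in> neighbours G z. y z + y t) \<le> (\<Sum>t \<in> S. y z + y t)"
      if "neighbours G z \<subseteq> S" "finite S" for z S
      using that y_pos by (intro sum_mono2) (auto intro: less_imp_le add_pos_pos)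
    define R where "R = neighbours G v - {a, b}"
    have R: "neighbours G v = insert a (insert b R)" "a \<notin> R" "b \<notin> R" "finite R"
      using ab by (auto simp: R_def)
    have "card (neighbours G v) = card R + 2"
      using R neq by simp
    then have cardR: "real (card R) = m - 2"
      by (simp add: m_def)
    have rest: "(\<Sum>t \<in> R. s + y t) = (m - 2) * (s + 6)" for s
    proof -
      have "(\<Sum>t \<in> R. s + y t) = (\<Sum>t \<in> R. s + 6)"
        using vn wv by (intro sum.cong) (auto simp: y_def R_def)
      then show ?thesis by (simp add: cardR)
    qed
    fix z assume "z \<in> pverts G"
    then consider "z = v" | "z = w" | "z = a" | "z = b" | "(v, z) \<in> parcs G" "z \<noteq> a" "z \<noteq> b"
      unfolding V by auto
    then have "(\<Sum>t \<in> neighbours G z. y z + y t) \<le> (m + 2) * y z"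
    proof cases
      case 1
      have "(\<Sum>t \<in> neighbours G v. y v + y t) = (4 * m + 12) + (4 * m + 7) + (m - 2) * (4 * m + 6)"
        using R(2-) neq rest[of "4 * m"] unfolding R(1) by (simp add: y_simps algebra_simps)
      also have "\<dots> \<le> (m + 2) * (4 * m)" using m by (simp add: algebra_simps)
      finally show ?thesis using 1 by (simp add: y_simps)
    next
      case 2
      \<comment> \<open>The bound obtained from this set is exactly (m+2) times the weight of
        \<open>w\<close>, so leaving out \<open>b\<close> is essential.\<close>
      have "neighbours G w \<subseteq> insert a R"
      proof
        fix t assume t: "t \<in> neighbours G w"
        then have "t \<noteq> v" "t \<noteq> b" "t \<noteq> w"
          using wv(2) bw arc_sym[of w] no_loops' by auto
        then show "t \<in> insert a R"
          using arc_v[of w t] t unfolding R_def by simp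
      qed
      from sub[OF this] R(2,4) have "(\<Sum>t \<in> neighbours G w. y w + y t) \<le> (2 * m + 12) + (m - 2) * (2 * m + 6)"
        using rest[of "2 * m"] by (simp add: y_simps algebra_simps)
      also have "\<dots> = (m + 2) * (2 * m)" by (simp add: algebra_simps)
      finally show ?thesis using 2 by (simp add: y_simps)
    next
      case 3
      \<comment> \<open>Any other neighbour of \<open>a\<close> is adjacent to \<open>v\<close> and
        would close a second triangle at \<open>v\<close>.\<close>
      have "neighbours G a \<subseteq> {v, b, w}"
        unfolding subset_iff in_neighbours_iff insert_iff empty_iff
        using unique_triangle[OF ab ab(1)] arc_v[of a] neq by blast
      from sub[OF this] have "(\<Sum>t \<in> neighbours G a. y a + y t) \<le> 43 + 6 * m"
        using neq wv by (simp add: y_simps)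
      also have "\<dots> \<le> (m + 2) * 12" using m by simp
      finally show ?thesis using 3 by (simp add: y_simps)
    next
      case 4
      have "neighbours G b \<subseteq> {v, a}"
        unfolding subset_iff in_neighbours_iff insert_iff empty_iff
        using unique_triangle[OF ab ab(2)] arc_v[of b] neq bw by blast
      from sub[OF this] have "(\<Sum>t \<in> neighbours G b. y b + y t) \<le> 26 + 4 * m"
        using neq wv by (simp add: y_simps)
      \<comment> \<open>This amounts to m >= 4, that is n >= 6, with equality at m = 4.\<close>
      also have "\<dots> \<le> (m + 2) * 7" using m by simp
      finally show ?thesis using 4 by (simp add: y_simps)
    next
      case 5
      have "neighbours G z \<subseteq> {v, w}"
        unfolding subset_iff in_neighbours_iff insert_iff empty_iff
        using unique_triangle[OF ab 5(1)] arc_v[of z] 5 by blast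
      from sub[OF this] have "(\<Sum>t \<in> neighbours G z. y z + y t) \<le> 2 * y z + 6 * m"
        using wv by (simp add: y_simps)
      also have "y z = 6" using 5 vn wv by (auto simp: y_def)
      finally show ?thesis by (simp add: \<open>y z = 6\<close>)
    qed
    then show "(\<Sum>t \<in> neighbours G z. y z + y t) \<le> card (pverts G) * y z"
      by (simp only: m)
  qed
  have "(a, w) \<notin> parcs G \<or> (b, w) \<notin> parcs G"
    using unique_apex[OF no_theta ab(3), of v w] ab wv arc_sym by blast
  then show ?thesis
    using main[OF ab] main[OF ab(2) ab(1)] ab(3) arc_sym by blast
qed

text \<open>Since \<open>v\<close> is adjacent to everything, an edge avoiding \<open>v\<close>
  closes a triangle at \<open>v\<close>, so \<open>unique_triangle\<close> leaves only
  \<open>ab\<close>.\<close>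

lemma dominating_triangle_iso:
  assumes v: "card (neighbours G v) + 1 = card (pverts G)"
    and ab: "(v, a) \<in> parcs G" "(v, b) \<in> parcs G" "(a, b) \<in> parcs G"
  shows "digraph_iso G (S_plus_graph (card (pverts G)) 1)"
proof (rule digraph_iso_S_plus)
  show "v \<in> pverts G" "a \<in> pverts G" "b \<in> pverts G" "a \<noteq> v" "b \<noteq> v" "a \<noteq> b"
    using ab no_loops' by (auto dest: in_arcsD1 in_arcsD2)
  have "v \<notin> neighbours G v" using no_loops' by auto
  then have "insert v (neighbours G v) = pverts G"
    using v \<open>v \<in> pverts G\<close> neighbours_subset
    by (intro card_subset_eq pair_finite_verts) auto
  then have dom: "(v, s) \<in> parcs G" if "s \<in> pverts G" "s \<noteq> v" for s
    using that by auto
  fix s t assume st: "s \<in> pverts G" "t \<in> pverts G"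
  have "s = a \<and> t = b \<or> s = b \<and> t = a" if "(s, t) \<in> parcs G" "s \<noteq> v" "t \<noteq> v"
    using unique_triangle[OF ab dom dom] st that by blast
  then show "(s, t) \<in> parcs G \<longleftrightarrow> s \<noteq> t \<and> (s = v \<or> t = v \<or> {s, t} = {a, b})"
    using dom[OF st(1)] dom[OF st(2)] ab arc_sym no_loops'
    by (auto simp: doubleton_eq_iff)
qed

lemma q_index_le_card_or_iso:
  assumes n: "card (pverts G) \<ge> 6"
  shows "q_index G \<le> card (pverts G) \<or> digraph_iso G (S_plus_graph (card (pverts G)) 1)"
proof (cases "\<exists>v a b. (v, a) \<in> parcs G \<and> (v, b) \<in> parcs G \<and> (a, b) \<in> parcs G \<and>
    card (pverts G) < card (neighbours G v) + 3")
  case False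
  then show ?thesis
    using n q_index_le_card by (metis card.empty not_less not_numeral_le_zero)
next
  case True
  then obtain v a b where ab: "(v, a) \<in> parcs G" "(v, b) \<in> parcs G" "(a, b) \<in> parcs G"
    and d: "card (pverts G) < card (neighbours G v) + 3" by blast
  have "card (neighbours G v) < card (pverts G)"
    using in_arcsD1[OF ab(1)] no_loops'
    by (intro psubset_card_mono pair_finite_verts) (auto simp: neighbours_def)
  with d have "card (neighbours G v) + 2 = card (pverts G) \<or> card (neighbours G v) + 1 = card (pverts G)"
    by linarith
  then show ?thesis
    using q_index_le_card_near_dominating[OF n _ ab] dominating_triangle_iso[OF _ ab] by blast
qed

end

theorem theorem1p4:
  fixes G :: "'a pair_pre_digraph" and n :: nat
  assumes "pair_graph G"
    and "card (pverts G) = n"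
    and "n \<ge> 6"
    and "\<not> contains_subgraph G (theta 1 2 2)"
    and "\<not> contains_subgraph G F5"
  shows "q_index G \<le> q_index (S_plus_graph n 1) \<and>
    (q_index G = q_index (S_plus_graph n 1) \<longleftrightarrow> digraph_iso G (S_plus_graph n 1))"
proof -
  interpret disjoint_triangles G
    using assms by (simp add: disjoint_triangles_def disjoint_triangles_axioms_def)
  have "q_index G = q_index (S_plus_graph n 1)" if "digraph_iso G (S_plus_graph n 1)"
    using that assms(3) by (intro q_index_digraph_iso assms(1) pair_graph_S_plus_graph) auto
  moreover have "q_index G \<le> n \<or> digraph_iso G (S_plus_graph n 1)"
    using q_index_le_card_or_iso assms(2,3) by blast
  moreover have "n < q_index (S_plus_graph n 1)"
    using assms(3) by (intro card_le_q_index_S_plus) simp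
  \<comment> \<open>The value n separates the two cases: without an isomorphism q(G) <= n lies
    strictly below the extremal value, which settles the equality case too.\<close>
  ultimately show ?thesis by auto
qed

end
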